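(* Consider the multi-objective location and path planning problem on a line graph with nodes $v_1,\dots,v_n$, edges $e_i=[v_i,v_{i+1}]$ ($i=1,\dots,n-1$) and demands $w_1,\dots,w_n\ge 0$. (1) For $j\in\{1,\dots,n\}$, the node $v_j$ is the unique Pareto optimal location if and only if $\sum_{i=1}^{j-1}w_i<\frac12\sum_{i=1}^n w_i$ and $\sum_{i=1}^{j}w_i>\frac12\sum_{i=1}^n w_i$. (2) Assume $w_i>0$ for all $i=1,\dots,n$. For $j\in\{1,\dots,n-1\}$, the whole edge $e_j$ (including the incident nodes $v_j$ and $v_{j+1}$) is Pareto optimal if and only if $\sum_{i=1}^{j}w_i=\frac12\sum_{i=1}^n w_i$. (3) In the general case $w_i\ge 0$ for all $i=1,\dots,n$, there may be many Pareto optimal edges (when some nodes have zero demand), but all nodes incident to such edges are also Pareto optimal. For $j\in\{1,\dots,n-1\}$, the edge $e_j$ (including the incident nodes $v_j$ and $v_{j+1}$) is Pareto optimal if and only if $\sum_{i=1}^{j-1}w_i\le\frac12\sum_{i=1}^n w_i$ and $\sum_{i=1}^{j}w_i=\frac12\sum_{i=1}^n w_i$.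
   Context: Let $p\in\mathbb{N}$, $p\ge 2$, and $\mathbb{R}^p_{\geq}=\{y\in\mathbb{R}^p : y_i\ge 0 \text{ for all } i,\ y\neq 0\}$. A line graph here means a path graph $G=(V,E)$ with ordered nodes $V=\{v_1,\dots,v_n\}$ and edges $E=\{e_i=[v_i,v_{i+1}] : i=1,\dots,n-1\}$. Each edge has a cost vector $c(e_i)\in\mathbb{R}^p_{\geq}$. Each node has a demand $w_i\ge 0$, with at least one $w_j>0$. The preference matrix $A$ is a fixed real $p\times p$ matrix with nonnegative entries and all diagonal entries equal to $1$. The problem is to choose a facility location minimizing, in the Pareto sense, the vector of total costs. For location at the node $v_j$ the objective vector is $$f=\sum_{i=1}^n w_i\sum_{k=\min\{i,j\}}^{\max\{i,j\}-1}A\cdot c(e_k)\in\mathbb{R}^p.$$ A location may also be a point $x$ in the interior of an edge $e_j$, at relative position $\alpha\in(0,1)$: the cost from $x$ to $v_j$ is then $\alpha\,c(e_j)$ and to $v_{j+1}$ is $(1-\alpha)\,c(e_j)$, costs to other nodes are obtained by adding the costs of the further edges on the unique path, and the objective vector is $A$ times the demand-weighted sum of the costs from $x$ to all nodes. A location is Pareto optimal if no other location has an objective vector that is componentwise less than or equal to, and different from, its own. An edge is Pareto optimal if every point on it is a Pareto optimal location. *)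

theory Defs
  imports "HOL-Analysis.Analysis"
begin

definition nonneg_nonzero :: "(real ^ 'p) set" where
  "nonneg_nonzero = {y. (\<forall>i. y $ i \<ge> 0) \<and> y \<noteq> 0}"

definition preference_matrix :: "real ^ 'p ^ 'p \<Rightarrow> bool" where
  "preference_matrix A \<longleftrightarrow> (\<forall>i j. A $ i $ j \<ge> 0) \<and> (\<forall>i. A $ i $ i = 1)"

text \<open>
  The line graph is represented by indices: the nodes are \<open>1, \<dots>, n\<close>, the edge \<open>k\<close> with
  \<open>1 \<le> k < n\<close> joins the nodes \<open>k\<close> and \<open>k + 1\<close>, and \<open>w\<close> and \<open>c\<close> are only relevant on these
  index ranges. The last condition forces \<open>n \<ge> 1\<close>.
\<close>

definition line_instance :: "nat \<Rightarrow> (nat \<Rightarrow> real) \<Rightarrow> (nat \<Rightarrow> real ^ 'p) \<Rightarrow> bool" where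
  "line_instance n w c \<longleftrightarrow>
     (\<forall>k\<in>{1..<n}. c k \<in> nonneg_nonzero) \<and>
     (\<forall>i\<in>{1..n}. w i \<ge> 0) \<and>
     (\<exists>i\<in>{1..n}. w i > 0)"

text \<open>
  \<open>Inner j \<alpha>\<close> is the interior point of edge \<open>j\<close> at relative position \<open>\<alpha>\<close>, measured from
  node \<open>j\<close>. The range \<open>0 < \<alpha> < 1\<close> is imposed in \<open>edge_interior\<close>, so that distinct locations
  are distinct points of the line graph.
\<close>

datatype location = Node nat | Inner nat real

definition edge_interior :: "nat \<Rightarrow> location set" where
  "edge_interior j = {Inner j \<alpha> | \<alpha>. 0 < \<alpha> \<and> \<alpha> < 1}"

definition edge_points :: "nat \<Rightarrow> location set" where
  "edge_points j = {Node j, Node (j + 1)} \<union> edge_interior j"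

definition locations :: "nat \<Rightarrow> location set" where
  "locations n = Node ` {1..n} \<union> (\<Union>j\<in>{1..<n}. edge_interior j)"

text \<open>The cost between the interior point \<open>Inner j \<alpha>\<close> and node \<open>i\<close> along the unique path.\<close>

definition inner_cost :: "(nat \<Rightarrow> real ^ 'p) \<Rightarrow> nat \<Rightarrow> real \<Rightarrow> nat \<Rightarrow> real ^ 'p" where
  "inner_cost c j \<alpha> i =
     (if i \<le> j then \<alpha> *\<^sub>R c j + (\<Sum>k\<in>{i..<j}. c k)
      else (1 - \<alpha>) *\<^sub>R c j + (\<Sum>k\<in>{j+1..<i}. c k))"

fun objective ::
  "real ^ 'p ^ 'p \<Rightarrow> nat \<Rightarrow> (nat \<Rightarrow> real) \<Rightarrow> (nat \<Rightarrow> real ^ 'p) \<Rightarrow> location \<Rightarrow> real ^ 'p" where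
  "objective A n w c (Node j) =
     (\<Sum>i=1..n. w i *\<^sub>R (\<Sum>k\<in>{min i j..<max i j}. A *v c k))"
| "objective A n w c (Inner j \<alpha>) = A *v (\<Sum>i=1..n. w i *\<^sub>R inner_cost c j \<alpha> i)"

definition dominates :: "real ^ 'p \<Rightarrow> real ^ 'p \<Rightarrow> bool" where
  "dominates y z \<longleftrightarrow> (\<forall>i. y $ i \<le> z $ i) \<and> y \<noteq> z"

definition pareto_optimal ::
  "real ^ 'p ^ 'p \<Rightarrow> nat \<Rightarrow> (nat \<Rightarrow> real) \<Rightarrow> (nat \<Rightarrow> real ^ 'p) \<Rightarrow> location \<Rightarrow> bool" where
  "pareto_optimal A n w c x \<longleftrightarrow>
     x \<in> locations n \<and>
     \<not> (\<exists>y\<in>locations n. dominates (objective A n w c y) (objective A n w c x))"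

text \<open>Pareto optimality of an edge always includes its two incident nodes.\<close>

definition pareto_optimal_edge ::
  "real ^ 'p ^ 'p \<Rightarrow> nat \<Rightarrow> (nat \<Rightarrow> real) \<Rightarrow> (nat \<Rightarrow> real ^ 'p) \<Rightarrow> nat \<Rightarrow> bool" where
  "pareto_optimal_edge A n w c j \<longleftrightarrow> (\<forall>x\<in>edge_points j. pareto_optimal A n w c x)"

end

theory Submission
  imports Defs
begin

text \<open>
  The objective separates over the edges. Let a location \<open>x\<close> have travelled the fraction
  \<open>t k\<close> of edge \<open>k\<close> when it is reached from node \<open>1\<close>: this is \<open>1\<close> on the edges to its left, \<open>0\<close>
  on those to its right, and \<open>\<alpha>\<close> on the edge that contains it. The demand of each node \<open>i \<le> k\<close>
  uses the fraction \<open>t k\<close> of edge \<open>k\<close>, that of each node \<open>i > k\<close> the fraction \<open>1 - t k\<close>. With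
  \<open>S k\<close> the demand of the nodes \<open>1, \<dots>, k\<close> and \<open>W\<close> the total demand, the objective is therefore
  the sum over \<open>k\<close> of \<open>(t k * S k + (1 - t k) * (W - S k)) *\<^sub>R A c(k)\<close>
  (lemma \<open>objective_eq_sum_edges\<close>).

  Since \<open>A\<close> has a unit diagonal and nonnegative entries, every vector \<open>A c(k)\<close> is nonnegative and
  nonzero. Each coefficient is affine in \<open>t k\<close>, with minimum \<open>min (S k) (W - S k)\<close> over the unit
  interval, and since \<open>S\<close>
  is monotone all these minima are attained simultaneously, at the weighted median node. That ideal
  point dominates every other objective vector, so a location is Pareto optimal exactly when
  \<open>t k = 1\<close> whenever \<open>S k < W / 2\<close> and \<open>t k = 0\<close> whenever \<open>S k > W / 2\<close>
  (lemma \<open>pareto_optimal_iff_travelled\<close>). Every claim is read off from this criterion; in particular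
  an edge is Pareto optimal if and only if the median condition \<open>S j = W / 2\<close> leaves its coefficient
  independent of the position on it.
\<close>

section \<open>Separation of the objective over the edges\<close>

text \<open>The fraction of edge \<open>k\<close> that lies between node \<open>1\<close> and the given location.\<close>

fun travelled :: "nat \<Rightarrow> location \<Rightarrow> real" where
  "travelled k (Node j) = (if k < j then 1 else 0)"
| "travelled k (Inner j \<alpha>) = (if k < j then 1 else if k = j then \<alpha> else 0)"

text \<open>The total demand of the nodes \<open>1, \<dots>, k\<close>.\<close>

definition cum_demand :: "(nat \<Rightarrow> real) \<Rightarrow> nat \<Rightarrow> real" where
  "cum_demand w k = (\<Sum>i=1..k. w i)"

text \<open>
  The amount of demand that crosses edge \<open>k\<close> when the facility lies at the fraction \<open>t\<close> of that edge,
  with demand counted in proportion to the part of the edge that it uses.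
\<close>

definition edge_load :: "nat \<Rightarrow> (nat \<Rightarrow> real) \<Rightarrow> nat \<Rightarrow> real \<Rightarrow> real" where
  "edge_load n w k t = t * cum_demand w k + (1 - t) * (cum_demand w n - cum_demand w k)"

lemma travelled_bounds:
  assumes "x \<in> locations n"
  shows "0 \<le> travelled k x" "travelled k x \<le> 1"
  using assms by (auto simp: locations_def edge_interior_def)

lemma node_distance_eq_sum_edges:
  fixes d :: "nat \<Rightarrow> 'a::real_vector"
  assumes "i \<in> {1..n}" "j \<in> {1..n}"
  shows "(\<Sum>k\<in>{min i j..<max i j}. d k) =
    (\<Sum>k\<in>{1..<n}. \<bar>travelled k (Node j) - travelled k (Node i)\<bar> *\<^sub>R d k)"
  by (rule sum.mono_neutral_cong_left) (use assms in \<open>auto simp: min_def max_def split: if_splits\<close>)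

lemma inner_cost_eq_sum_edges:
  assumes "i \<in> {1..n}" "j \<in> {1..<n}" "0 < \<alpha>" "\<alpha> < 1"
  shows "inner_cost c j \<alpha> i =
    (\<Sum>k\<in>{1..<n}. \<bar>travelled k (Inner j \<alpha>) - travelled k (Node i)\<bar> *\<^sub>R c k)"
proof -
  have "(\<Sum>k\<in>{1..<n}. \<bar>travelled k (Inner j \<alpha>) - travelled k (Node i)\<bar> *\<^sub>R c k) =
      (if i \<le> j then \<alpha> else 1 - \<alpha>) *\<^sub>R c j +
      (\<Sum>k\<in>{1..<n} - {j}. \<bar>travelled k (Inner j \<alpha>) - travelled k (Node i)\<bar> *\<^sub>R c k)"
    using assms by (subst sum.remove[of _ j]) auto
  also have "(\<Sum>k\<in>{1..<n} - {j}. \<bar>travelled k (Inner j \<alpha>) - travelled k (Node i)\<bar> *\<^sub>R c k) =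
      (\<Sum>k\<in>(if i \<le> j then {i..<j} else {j+1..<i}). c k)"
    by (rule sum.mono_neutral_cong_right) (use assms in \<open>auto split: if_splits\<close>)
  finally show ?thesis
    by (auto simp: inner_cost_def)
qed

lemma sum_demand_travelled:
  assumes "k \<in> {1..<n}" "0 \<le> t" "t \<le> 1"
  shows "(\<Sum>i=1..n. w i * \<bar>t - travelled k (Node i)\<bar>) = edge_load n w k t"
proof -
  have split: "(\<Sum>i=1..n. f i) = (\<Sum>i=1..k. f i) + (\<Sum>i=Suc k..n. f i)" for f :: "nat \<Rightarrow> real"
    using assms(1) sum.ub_add_nat[of 1 k f "n - k"] by simp
  have "(\<Sum>i=1..k. w i * \<bar>t - travelled k (Node i)\<bar>) = t * cum_demand w k"
    using assms by (auto simp: cum_demand_def sum_distrib_left mult.commute intro!: sum.cong)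
  moreover have "(\<Sum>i=Suc k..n. w i * \<bar>t - travelled k (Node i)\<bar>) =
      (1 - t) * (\<Sum>i=Suc k..n. w i)"
    using assms by (auto simp: sum_distrib_left mult.commute intro!: sum.cong)
  moreover have "(\<Sum>i=Suc k..n. w i) = cum_demand w n - cum_demand w k"
    using split[of w] by (simp add: cum_demand_def)
  ultimately show ?thesis
    unfolding split by (simp only: edge_load_def)
qed

lemma sum_distances_eq_sum_loads:
  fixes d :: "nat \<Rightarrow> real ^ 'p"
  assumes "x \<in> locations n"
  shows "(\<Sum>i=1..n. w i *\<^sub>R (\<Sum>k\<in>{1..<n}. \<bar>travelled k x - travelled k (Node i)\<bar> *\<^sub>R d k)) =
    (\<Sum>k\<in>{1..<n}. edge_load n w k (travelled k x) *\<^sub>R d k)"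
proof -
  have "(\<Sum>i=1..n. w i *\<^sub>R (\<Sum>k\<in>{1..<n}. \<bar>travelled k x - travelled k (Node i)\<bar> *\<^sub>R d k)) =
      (\<Sum>k\<in>{1..<n}. \<Sum>i=1..n. (w i * \<bar>travelled k x - travelled k (Node i)\<bar>) *\<^sub>R d k)"
    by (subst sum.swap) (simp add: scaleR_sum_right del: travelled.simps)
  also have "\<dots> = (\<Sum>k\<in>{1..<n}. edge_load n w k (travelled k x) *\<^sub>R d k)"
    unfolding scaleR_sum_left[symmetric] using travelled_bounds[OF assms]
    by (intro sum.cong refl arg_cong2[where f = scaleR] sum_demand_travelled)
  finally show ?thesis .
qed

lemma objective_eq_sum_edges:
  fixes A :: "real ^ 'p ^ 'p"
  assumes "x \<in> locations n"
  shows "objective A n w c x = (\<Sum>k\<in>{1..<n}. edge_load n w k (travelled k x) *\<^sub>R (A *v c k))"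
proof (cases x)
  case (Node j)
  then have j: "j \<in> {1..n}"
    using assms by (auto simp: locations_def edge_interior_def)
  have "objective A n w c x = (\<Sum>i=1..n. w i *\<^sub>R
      (\<Sum>k\<in>{1..<n}. \<bar>travelled k x - travelled k (Node i)\<bar> *\<^sub>R (A *v c k)))"
    unfolding Node objective.simps by (simp only: node_distance_eq_sum_edges j cong: sum.cong)
  also have "\<dots> = (\<Sum>k\<in>{1..<n}. edge_load n w k (travelled k x) *\<^sub>R (A *v c k))"
    by (rule sum_distances_eq_sum_loads[OF assms])
  finally show ?thesis .
next
  case (Inner j \<alpha>)
  then have j: "j \<in> {1..<n}" "0 < \<alpha>" "\<alpha> < 1"
    using assms by (auto simp: locations_def edge_interior_def)
  have "(\<Sum>i=1..n. w i *\<^sub>R inner_cost c j \<alpha> i) = (\<Sum>i=1..n. w i *\<^sub>R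
      (\<Sum>k\<in>{1..<n}. \<bar>travelled k x - travelled k (Node i)\<bar> *\<^sub>R c k))"
    unfolding Inner by (simp only: inner_cost_eq_sum_edges j cong: sum.cong)
  also have "\<dots> = (\<Sum>k\<in>{1..<n}. edge_load n w k (travelled k x) *\<^sub>R c k)"
    by (rule sum_distances_eq_sum_loads[OF assms])
  finally have "objective A n w c x = A *v (\<Sum>k\<in>{1..<n}. edge_load n w k (travelled k x) *\<^sub>R c k)"
    by (simp add: Inner)
  then show ?thesis
    by (simp add: linear_sum[OF matrix_vector_mul_linear] matrix_vector_mult_scaleR)
qed

section \<open>Minimal edge loads and Pareto optimality\<close>

lemma preference_matrix_mult_nonneg_nonzero:
  assumes "preference_matrix A" "y \<in> nonneg_nonzero"
  shows "A *v y \<in> nonneg_nonzero"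
proof -
  have A: "\<And>i j. 0 \<le> A $ i $ j" "\<And>i. A $ i $ i = 1"
    using assms(1) by (auto simp: preference_matrix_def)
  have y: "\<And>i. 0 \<le> y $ i" "y \<noteq> 0"
    using assms(2) by (auto simp: nonneg_nonzero_def)
  have ge: "y $ i \<le> (A *v y) $ i" for i
    \<comment> \<open>Only the diagonal term of the row is kept.\<close>
    using member_le_sum[of i UNIV "\<lambda>j. A $ i $ j * y $ j"] A y(1)
    by (simp add: matrix_vector_mult_def)
  obtain i where "y $ i \<noteq> 0"
    using y(2) by (auto simp: vec_eq_iff)
  then have "0 < (A *v y) $ i"
    using ge[of i] y(1)[of i] by linarith
  then have "A *v y \<noteq> 0"
    by auto
  moreover have "0 \<le> (A *v y) $ i" for i
    using ge[of i] y(1)[of i] by linarith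
  ultimately show ?thesis
    by (simp add: nonneg_nonzero_def)
qed

lemma cum_demand_0: "cum_demand w 0 = 0"
  by (simp add: cum_demand_def)

lemma cum_demand_Suc: "cum_demand w (Suc k) = cum_demand w k + w (Suc k)"
  by (simp add: cum_demand_def)

lemma cum_demand_mono:
  assumes "line_instance n w c" "k \<le> l" "l \<le> n"
  shows "cum_demand w k \<le> cum_demand w l"
  unfolding cum_demand_def
  by (rule sum_mono2) (use assms in \<open>auto simp: line_instance_def\<close>)

lemma cum_demand_total_pos:
  assumes "line_instance n w c"
  shows "0 < cum_demand w n"
  using assms unfolding cum_demand_def line_instance_def by (auto intro!: sum_pos2)

text \<open>The fraction \<open>t\<close> of edge \<open>k\<close> has least possible load.\<close>

definition load_minimal :: "nat \<Rightarrow> (nat \<Rightarrow> real) \<Rightarrow> nat \<Rightarrow> real \<Rightarrow> bool" where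
  "load_minimal n w k t \<longleftrightarrow>
     (2 * cum_demand w k < cum_demand w n \<longrightarrow> t = 1) \<and>
     (2 * cum_demand w k > cum_demand w n \<longrightarrow> t = 0)"

lemma edge_load_diff:
  "edge_load n w k s - edge_load n w k t = (s - t) * (2 * cum_demand w k - cum_demand w n)"
  by (simp add: edge_load_def algebra_simps)

lemma edge_load_le:
  assumes "load_minimal n w k t" "0 \<le> s" "s \<le> 1"
  shows "edge_load n w k t \<le> edge_load n w k s"
proof -
  have "0 \<le> (s - t) * (2 * cum_demand w k - cum_demand w n)"
    using assms by (auto simp: load_minimal_def zero_le_mult_iff)
  then show ?thesis
    using edge_load_diff[of n w k s t] by linarith
qed

lemma load_minimal_if_edge_load_eq:
  assumes "load_minimal n w k t" "edge_load n w k s = edge_load n w k t"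
  shows "load_minimal n w k s"
  using assms edge_load_diff[of n w k s t] by (auto simp: load_minimal_def)

text \<open>
  The weighted median node minimises the load of all edges at once, by monotonicity of the cumulative
  demand.
\<close>

lemma exists_median_node:
  assumes "line_instance n w c"
  obtains m where "m \<in> {1..n}" "\<And>k. k \<in> {1..<n} \<Longrightarrow> load_minimal n w k (travelled k (Node m))"
proof -
  define m where "m = (LEAST m. cum_demand w n \<le> 2 * cum_demand w m)"
  have W: "0 < cum_demand w n"
    using assms by (rule cum_demand_total_pos)
  then have n: "cum_demand w n \<le> 2 * cum_demand w n"
    by simp
  have m: "cum_demand w n \<le> 2 * cum_demand w m" "m \<le> n"
    unfolding m_def using n by (rule LeastI, rule Least_le)
  have below: "2 * cum_demand w k < cum_demand w n" if "k < m" for k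
    using not_less_Least[of k "\<lambda>m. cum_demand w n \<le> 2 * cum_demand w m"] that
    by (simp add: m_def)
  have "m \<noteq> 0"
    using m(1) W by (intro notI) (simp add: cum_demand_0)
  with m(2) have m1: "m \<in> {1..n}"
    by simp
  have "load_minimal n w k (travelled k (Node m))" if "k \<in> {1..<n}" for k
    using below[of k] m(1) cum_demand_mono[OF assms, of m k] that
    by (auto simp: load_minimal_def)
  with m1 show ?thesis
    by (rule that)
qed

lemma objective_le_if_load_minimal:
  assumes "preference_matrix A" "line_instance n w c"
    and "x \<in> locations n" "y \<in> locations n"
    and "\<And>k. k \<in> {1..<n} \<Longrightarrow> load_minimal n w k (travelled k x)"
  shows "objective A n w c x $ i \<le> objective A n w c y $ i"
proof -
  have "0 \<le> (A *v c k) $ i" if "k \<in> {1..<n}" for k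
    using preference_matrix_mult_nonneg_nonzero[OF assms(1), of "c k"] assms(2) that
    by (auto simp: line_instance_def nonneg_nonzero_def)
  then show ?thesis
    using assms(3-5) travelled_bounds
    by (auto simp: objective_eq_sum_edges intro!: sum_mono mult_right_mono edge_load_le
        simp del: travelled.simps)
qed

lemma load_minimal_if_objective_eq:
  assumes "preference_matrix A" "line_instance n w c"
    and "x \<in> locations n" "y \<in> locations n"
    and "\<And>k. k \<in> {1..<n} \<Longrightarrow> load_minimal n w k (travelled k x)"
    and "objective A n w c y = objective A n w c x"
    and "k \<in> {1..<n}"
  shows "load_minimal n w k (travelled k y)"
proof -
  have pos: "A *v c k \<in> nonneg_nonzero" if "k \<in> {1..<n}" for k
    using preference_matrix_mult_nonneg_nonzero[OF assms(1), of "c k"] assms(2) that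
    by (auto simp: line_instance_def)
  obtain i where i: "(A *v c k) $ i \<noteq> 0"
    using pos[OF assms(7)] by (auto simp: nonneg_nonzero_def vec_eq_iff)
  let ?h = "\<lambda>x k. edge_load n w k (travelled k x) * (A *v c k) $ i"
  \<comment> \<open>Two sums with termwise comparable summands that agree have equal summands.\<close>
  have "(\<Sum>k\<in>{1..<n}. ?h y k) = (\<Sum>k\<in>{1..<n}. ?h x k)"
    using arg_cong[OF assms(6), of "\<lambda>v. v $ i"] assms(3,4) by (simp add: objective_eq_sum_edges)
  then have sum0: "(\<Sum>k\<in>{1..<n}. ?h y k - ?h x k) = 0"
    by (simp add: sum_subtractf)
  have "0 \<le> ?h y k - ?h x k" if "k \<in> {1..<n}" for k
    using edge_load_le[OF assms(5)[OF that]] travelled_bounds[OF assms(4), of k] pos[OF that]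
    by (auto simp: nonneg_nonzero_def intro!: mult_right_mono)
  then have "?h y k - ?h x k = 0"
    using sum_nonneg_0[OF _ _ sum0 assms(7)] by blast
  then have "edge_load n w k (travelled k y) = edge_load n w k (travelled k x)"
    using i by simp
  then show ?thesis
    using load_minimal_if_edge_load_eq assms(5,7) by blast
qed

lemma pareto_optimal_iff_travelled:
  assumes "preference_matrix A" "line_instance n w c"
  shows "pareto_optimal A n w c x \<longleftrightarrow>
    x \<in> locations n \<and> (\<forall>k\<in>{1..<n}. load_minimal n w k (travelled k x))"
proof
  assume opt: "pareto_optimal A n w c x"
  then have x: "x \<in> locations n"
    by (simp add: pareto_optimal_def)
  obtain m where m: "m \<in> {1..n}" "\<And>k. k \<in> {1..<n} \<Longrightarrow> load_minimal n w k (travelled k (Node m))"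
    using exists_median_node[OF assms(2)] by blast
  have loc: "Node m \<in> locations n"
    using m(1) by (simp add: locations_def)
  have "objective A n w c x = objective A n w c (Node m)"
    using opt loc objective_le_if_load_minimal[OF assms loc x m(2)]
    unfolding pareto_optimal_def dominates_def by metis
  then show "x \<in> locations n \<and> (\<forall>k\<in>{1..<n}. load_minimal n w k (travelled k x))"
    using load_minimal_if_objective_eq[OF assms loc x m(2)] x by blast
next
  assume x: "x \<in> locations n \<and> (\<forall>k\<in>{1..<n}. load_minimal n w k (travelled k x))"
  have "objective A n w c y = objective A n w c x"
    if y: "y \<in> locations n" and le: "\<forall>i. objective A n w c y $ i \<le> objective A n w c x $ i" for y
    using objective_le_if_load_minimal[OF assms _ y] x le
    by (auto simp: vec_eq_iff intro: antisym)
  then show "pareto_optimal A n w c x"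
    using x by (auto simp: pareto_optimal_def dominates_def)
qed

section \<open>Unique Pareto optimal nodes and Pareto optimal edges\<close>

lemma unique_pareto_optimal_node_iff:
  assumes "preference_matrix A" "line_instance n w c" "j \<in> {1..n}"
  shows "{x. pareto_optimal A n w c x} = {Node j} \<longleftrightarrow>
    2 * cum_demand w (j - 1) < cum_demand w n \<and> cum_demand w n < 2 * cum_demand w j"
    (is "?L \<longleftrightarrow> ?R")
proof
  note opt_iff = pareto_optimal_iff_travelled[OF assms(1,2)]
  have W: "0 < cum_demand w n"
    using assms(2) by (rule cum_demand_total_pos)
  assume L: ?L
  then have min: "load_minimal n w k (travelled k (Node j))" if "k \<in> {1..<n}" for k
    using that opt_iff[of "Node j"] by blast
  \<comment> \<open>If an edge at node \<open>j\<close> halved the demand, its other end node would be optimal as well.\<close>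
  have other: "\<exists>k\<in>{1..<n}. \<not> load_minimal n w k (travelled k (Node i))"
    if "i \<in> {1..n}" "i \<noteq> j" for i
  proof -
    have "Node i \<in> locations n"
      using that(1) by (simp add: locations_def)
    moreover have "\<not> pareto_optimal A n w c (Node i)"
      using L that(2) by blast
    ultimately show ?thesis
      using opt_iff[of "Node i"] by blast
  qed
  have "2 * cum_demand w (j - 1) < cum_demand w n"
  proof (cases "j = 1")
    case False
    then have j: "j - 1 \<in> {1..<n}" "j - 1 \<in> {1..n}" "j - 1 \<noteq> j"
      using assms(3) by auto
    from other[OF j(2,3)] obtain k where
      k: "k \<in> {1..<n}" "\<not> load_minimal n w k (travelled k (Node (j - 1)))"
      by blast
    then have "k = j - 1"
      using min[OF k(1)] by (cases "k < j - 1"; cases "k < j") auto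
    then show ?thesis
      using k min[OF k(1)] by (auto simp: load_minimal_def split: if_splits)
  qed (simp add: cum_demand_0 W)
  moreover have "cum_demand w n < 2 * cum_demand w j"
  proof (cases "j = n")
    case False
    then have j: "j \<in> {1..<n}" "j + 1 \<in> {1..n}" "j + 1 \<noteq> j"
      using assms(3) by auto
    from other[OF j(2,3)] obtain k where
      k: "k \<in> {1..<n}" "\<not> load_minimal n w k (travelled k (Node (j + 1)))"
      by blast
    then have "k = j"
      using min[OF k(1)] by (cases "k < j + 1"; cases "k < j") auto
    then show ?thesis
      using k min[OF k(1)] by (auto simp: load_minimal_def split: if_splits)
  qed (simp add: W)
  ultimately show ?R ..
next
  note opt_iff = pareto_optimal_iff_travelled[OF assms(1,2)]
  assume R: ?R
  have lt: "2 * cum_demand w k < cum_demand w n" if "k < j" for k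
  proof -
    have "cum_demand w k \<le> cum_demand w (j - 1)"
      using cum_demand_mono[OF assms(2), of k "j - 1"] that assms(3) by simp
    then show ?thesis
      using R by linarith
  qed
  have gt: "2 * cum_demand w k > cum_demand w n" if "k \<ge> j" "k < n" for k
    using cum_demand_mono[OF assms(2), of j k] R that by auto
  have "load_minimal n w k (travelled k (Node j))" if "k \<in> {1..<n}" for k
    using lt[of k] gt[of k] that by (cases "k < j") (auto simp: load_minimal_def)
  then have "pareto_optimal A n w c (Node j)"
    using assms(3) unfolding opt_iff locations_def by blast
  moreover have "x = Node j" if "pareto_optimal A n w c x" for x
  proof -
    have x: "x \<in> locations n" "\<And>k. k \<in> {1..<n} \<Longrightarrow> load_minimal n w k (travelled k x)"
      using that by (auto simp: opt_iff)
    have t: "travelled k x = (if k < j then 1 else 0)" if "k \<in> {1..<n}" for k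
      using x(2)[OF that] lt[of k] gt[of k] that by (auto simp: load_minimal_def)
    show ?thesis
    proof (cases x)
      case (Node i)
      then have i: "i \<in> {1..n}"
        using x(1) by (auto simp: locations_def edge_interior_def)
      have "\<not> i < j" "\<not> j < i"
        using t[of i] t[of j] i assms(3) Node by auto
      then show ?thesis
        using Node by simp
    next
      case (Inner i \<alpha>)
      then have "i \<in> {1..<n}" "0 < \<alpha>" "\<alpha> < 1"
        using x(1) by (auto simp: locations_def edge_interior_def)
      then show ?thesis
        using t[of i] Inner by (auto split: if_splits)
    qed
  qed
  ultimately show ?L
    by blast
qed

lemma midpoint_mem_edge_interior: "Inner j (1/2) \<in> edge_interior j"
  unfolding edge_interior_def by (rule CollectI, rule exI[of _ "1/2"]) simp

lemma half_demand_if_interior_pareto_optimal: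
  assumes "preference_matrix A" "line_instance n w c" "j \<in> {1..<n}"
    and "pareto_optimal A n w c (Inner j \<alpha>)" "0 < \<alpha>" "\<alpha> < 1"
  shows "2 * cum_demand w j = cum_demand w n"
proof -
  have "load_minimal n w j (travelled j (Inner j \<alpha>))"
    using assms pareto_optimal_iff_travelled[OF assms(1,2)] by blast
  then show ?thesis
    using assms(5,6) by (auto simp: load_minimal_def)
qed

lemma pareto_optimal_edge_iff:
  assumes "preference_matrix A" "line_instance n w c" "j \<in> {1..<n}"
  shows "pareto_optimal_edge A n w c j \<longleftrightarrow> 2 * cum_demand w j = cum_demand w n"
proof
  assume "pareto_optimal_edge A n w c j"
  moreover have "Inner j (1/2) \<in> edge_points j"
    using midpoint_mem_edge_interior by (simp add: edge_points_def)
  ultimately have "pareto_optimal A n w c (Inner j (1/2))"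
    unfolding pareto_optimal_edge_def by blast
  then show "2 * cum_demand w j = cum_demand w n"
    using half_demand_if_interior_pareto_optimal[OF assms] by simp
next
  assume half: "2 * cum_demand w j = cum_demand w n"
  have le: "2 * cum_demand w k \<le> cum_demand w n" if "k \<le> j" for k
    using cum_demand_mono[OF assms(2), of k j] half that assms(3) by auto
  have ge: "2 * cum_demand w k \<ge> cum_demand w n" if "k \<ge> j" "k < n" for k
    using cum_demand_mono[OF assms(2), of j k] half that by auto
  have "pareto_optimal A n w c x" if x: "x \<in> edge_points j" for x
    unfolding pareto_optimal_iff_travelled[OF assms(1,2)]
  proof (intro conjI ballI)
    show "x \<in> locations n"
      using x assms(3) by (auto simp: edge_points_def locations_def)
    show "load_minimal n w k (travelled k x)" if "k \<in> {1..<n}" for k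
    proof (cases k j rule: linorder_cases)
      case less
      then show ?thesis
        using le[of k] x by (auto simp: load_minimal_def edge_points_def edge_interior_def)
    next
      case equal
      then show ?thesis
        using half by (simp add: load_minimal_def)
    next
      case greater
      then show ?thesis
        using ge[of k] x that by (auto simp: load_minimal_def edge_points_def edge_interior_def)
    qed
  qed
  then show "pareto_optimal_edge A n w c j"
    by (simp add: pareto_optimal_edge_def)
qed

text \<open>
  Placing unit demands at the two end nodes and none in between makes every edge Pareto optimal.
\<close>

lemma exists_many_pareto_optimal_edges:
  fixes A :: "real ^ 'p ^ 'p"
  assumes "preference_matrix A"
  shows "\<exists>n w (c :: nat \<Rightarrow> real ^ 'p). line_instance n w c \<and> (\<exists>i\<in>{1..n}. w i = 0) \<and>
    m \<le> card {j\<in>{1..<n}. pareto_optimal_edge A n w c j}"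
proof -
  \<comment> \<open>Three nodes beyond \<open>m\<close> guarantee an inner node, even for \<open>m = 0\<close>.\<close>
  define n where "n = m + 3"
  define w :: "nat \<Rightarrow> real" where "w i = (if i = 1 \<or> i = n then 1 else 0)" for i
  define c :: "nat \<Rightarrow> real ^ 'p" where "c k = 1" for k
  have inst: "line_instance n w c"
    by (auto simp: line_instance_def w_def c_def nonneg_nonzero_def n_def vec_eq_iff)
  have one: "cum_demand w j = 1" if "j \<in> {1..<n}" for j
  proof -
    have "cum_demand w j = (\<Sum>i=1..j. if i = 1 then 1 else 0)"
      unfolding cum_demand_def using that by (intro sum.cong) (auto simp: w_def)
    then show ?thesis
      using that by simp
  qed
  have "cum_demand w n = cum_demand w (n - 1) + w n"
    using cum_demand_Suc[of w "n - 1"] by (simp add: n_def numeral_eq_Suc)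
  then have "cum_demand w n = 2"
    using one[of "n - 1"] by (simp add: w_def n_def)
  then have "{j\<in>{1..<n}. pareto_optimal_edge A n w c j} = {1..<n}"
    using one pareto_optimal_edge_iff[OF assms inst] by auto
  then have "m \<le> card {j\<in>{1..<n}. pareto_optimal_edge A n w c j}"
    by (simp add: n_def)
  moreover have "\<exists>i\<in>{1..n}. w i = 0"
    by (rule bexI[of _ 2]) (auto simp: w_def n_def)
  ultimately show ?thesis
    using inst by (intro exI[of _ n] exI[of _ w] exI[of _ c] conjI)
qed

lemma zero_demand_if_two_pareto_optimal_edges:
  assumes "preference_matrix A" "line_instance n w c"
    and "2 \<le> card {j\<in>{1..<n}. pareto_optimal_edge A n w c j}"
  shows "\<exists>i\<in>{1..n}. w i = 0"
proof -
  let ?E = "{j\<in>{1..<n}. pareto_optimal_edge A n w c j}"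
  have "\<not> card ?E \<le> Suc 0" "finite ?E"
    using assms(3) by simp_all
  then obtain a b where "a \<in> ?E" "b \<in> ?E" "a \<noteq> b"
    unfolding card_le_Suc0_iff_eq[OF \<open>finite ?E\<close>] by blast
  then obtain j l where jl: "j \<in> ?E" "l \<in> ?E" "j < l"
    by (metis linorder_neqE_nat)
  then have eq: "cum_demand w j = cum_demand w l"
    using pareto_optimal_edge_iff[OF assms(1,2)] by auto
  \<comment> \<open>The cumulative demand is constant from \<open>j\<close> to \<open>l\<close>, so node \<open>j + 1\<close> carries no demand.\<close>
  have "cum_demand w j + w (Suc j) = cum_demand w (Suc j)"
    by (simp add: cum_demand_Suc)
  also have "\<dots> \<le> cum_demand w l"
    using cum_demand_mono[OF assms(2), of "Suc j" l] jl by auto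
  finally have "w (Suc j) \<le> 0"
    using eq by simp
  moreover have j: "Suc j \<in> {1..n}"
    using jl by auto
  moreover have "0 \<le> w (Suc j)"
    using assms(2) j unfolding line_instance_def by blast
  ultimately show ?thesis
    by (meson antisym)
qed

theorem theorem7:
  fixes A :: "real ^ 'p ^ 'p"
    and n :: nat
    and w :: "nat \<Rightarrow> real"
    and c :: "nat \<Rightarrow> real ^ 'p"
  assumes "CARD('p) \<ge> 2"
    and "preference_matrix A"
    and "line_instance n w c"
  shows
    "(\<forall>j\<in>{1..n}.
        {x. pareto_optimal A n w c x} = {Node j} \<longleftrightarrow>
        (\<Sum>i\<in>{1..<j}. w i) < 1/2 * (\<Sum>i=1..n. w i) \<and>
        (\<Sum>i=1..j. w i) > 1/2 * (\<Sum>i=1..n. w i))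
     \<and>
     ((\<forall>i\<in>{1..n}. w i > 0) \<longrightarrow>
      (\<forall>j\<in>{1..<n}.
        pareto_optimal_edge A n w c j \<longleftrightarrow>
        (\<Sum>i=1..j. w i) = 1/2 * (\<Sum>i=1..n. w i)))
     \<and>
     (\<forall>m. \<exists>n' w' (c' :: nat \<Rightarrow> real ^ 'p).
        line_instance n' w' c' \<and> (\<exists>i\<in>{1..n'}. w' i = 0) \<and>
        card {j\<in>{1..<n'}. pareto_optimal_edge A n' w' c' j} \<ge> m)
     \<and>
     (card {j\<in>{1..<n}. pareto_optimal_edge A n w c j} \<ge> 2 \<longrightarrow> (\<exists>i\<in>{1..n}. w i = 0))
     \<and>
     (\<forall>j\<in>{1..<n}.
        (\<forall>x\<in>edge_interior j. pareto_optimal A n w c x) \<longrightarrow>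
        pareto_optimal A n w c (Node j) \<and> pareto_optimal A n w c (Node (j + 1)))
     \<and>
     (\<forall>j\<in>{1..<n}.
        pareto_optimal_edge A n w c j \<longleftrightarrow>
        (\<Sum>i\<in>{1..<j}. w i) \<le> 1/2 * (\<Sum>i=1..n. w i) \<and>
        (\<Sum>i=1..j. w i) = 1/2 * (\<Sum>i=1..n. w i))"
proof -
  note inst = assms(2,3)
  have before: "(\<Sum>i\<in>{1..<j}. w i) = cum_demand w (j - 1)" if "1 \<le> j" for j
  proof -
    have "{1..<j} = {1..j - 1}"
      using that by auto
    then show ?thesis
      by (simp add: cum_demand_def)
  qed
  have upto: "(\<Sum>i=1..j. w i) = cum_demand w j" for j
    by (simp add: cum_demand_def)
  have unique: "{x. pareto_optimal A n w c x} = {Node j} \<longleftrightarrow>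
      (\<Sum>i\<in>{1..<j}. w i) < 1/2 * (\<Sum>i=1..n. w i) \<and>
      (\<Sum>i=1..j. w i) > 1/2 * (\<Sum>i=1..n. w i)" if "j \<in> {1..n}" for j
  proof -
    have "1 \<le> j"
      using that by simp
    then show ?thesis
      unfolding unique_pareto_optimal_node_iff[OF inst that] before[OF \<open>1 \<le> j\<close>] upto by linarith
  qed
  have edge: "pareto_optimal_edge A n w c j \<longleftrightarrow> (\<Sum>i=1..j. w i) = 1/2 * (\<Sum>i=1..n. w i)"
    if "j \<in> {1..<n}" for j
    unfolding pareto_optimal_edge_iff[OF inst that] upto by auto
  have before_le: "(\<Sum>i\<in>{1..<j}. w i) \<le> (\<Sum>i=1..j. w i)" if "j \<in> {1..<n}" for j
    using that cum_demand_mono[OF inst(2), of "j - 1" j] before[of j] upto[of j] by simp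
  have ends: "pareto_optimal A n w c (Node j) \<and> pareto_optimal A n w c (Node (j + 1))"
    if "j \<in> {1..<n}" and int: "\<forall>x\<in>edge_interior j. pareto_optimal A n w c x" for j
  proof -
    have "2 * cum_demand w j = cum_demand w n"
      using half_demand_if_interior_pareto_optimal[OF inst that(1), of "1/2"]
        midpoint_mem_edge_interior int by simp
    then have "pareto_optimal_edge A n w c j"
      using pareto_optimal_edge_iff[OF inst that(1)] by simp
    then show ?thesis
      by (simp add: pareto_optimal_edge_def edge_points_def)
  qed
  have edge': "pareto_optimal_edge A n w c j \<longleftrightarrow>
      (\<Sum>i\<in>{1..<j}. w i) \<le> 1/2 * (\<Sum>i=1..n. w i) \<and>
      (\<Sum>i=1..j. w i) = 1/2 * (\<Sum>i=1..n. w i)" if "j \<in> {1..<n}" for j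
    using edge[OF that] before_le[OF that] by auto
  show ?thesis
    apply (intro conjI)
    subgoal by (rule ballI) (rule unique)
    subgoal by (rule impI, rule ballI) (rule edge)
    subgoal by (rule allI) (rule exists_many_pareto_optimal_edges[OF assms(2)])
    subgoal by (rule impI) (rule zero_demand_if_two_pareto_optimal_edges[OF inst])
    subgoal by (rule ballI, rule impI) (rule ends)
    subgoal by (rule ballI) (rule edge')
    done
qed

end
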